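(* Assume hypotheses (i)–(iv) of the context. Let $\overline U=(\overline\rho,\overline u,\overline\theta)\in\mathcal U$ be a constant state, $s\ge3$, and let $$U=(\rho,u,\theta)\in X_s\big((0,T);\tfrac12m_1,2M_1,\tfrac12m_2,2M_2\big)$$ be the local solution to the Cauchy problem for the Navier–Stokes–Fourier–Korteweg system of the context, for any $T\le T_1$, with initial data satisfying the hypotheses of the local existence theorem recalled in the context, and with constants $m_j,M_j$, $j=1,2$, such that $U(\cdot,t)\in\mathcal U$ a.e. in $x\in\mathbb R$ and for all $t\in[0,T]$. Then the matrix field $D_UF^0(U,U_x)$ is invertible (for all $t\in[0,T]$ and a.e. $x\in\mathbb R$), where $$F^0(U,U_x)=\begin{pmatrix}\rho\\ \rho u\\ \rho\big(\varepsilon(\rho,\theta,\rho_x)+\tfrac12u^2\big)\end{pmatrix}$$ and $D_UF^0$ is its Jacobian with respect to $U=(\rho,u,\theta)$ only ($U_x$ being treated as an independent variable).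
   Context: **System.** For $x\in\mathbb R$, $t>0$ and unknowns $\rho$ (density), $u$ (velocity), $\theta$ (temperature): $$\rho_t+(\rho u)_x=0,\qquad (\rho u)_t+(\rho u^2+p)_x=(\mu u_x+K)_x,$$ $$\big(\rho\varepsilon+\tfrac12\rho u^2\big)_t+\big(\rho u(\varepsilon+\tfrac12u^2)+pu\big)_x=\big(\alpha\theta_x+\mu uu_x+uK+w\big)_x,$$ $$K=k\rho\rho_{xx}+\rho k_x\rho_x-\tfrac12k_\rho\rho\rho_x^2-\tfrac12k\rho_x^2,\qquad w=-k\rho\rho_xu_x,\qquad k(\rho,\theta)=2\rho\kappa(\rho,\theta),$$ $$\varepsilon(\rho,\theta,\rho_x)=e(\rho,\theta)+\big(\kappa(\rho,\theta)-\theta\kappa_\theta(\rho,\theta)\big)\rho_x^2 .$$ **Hypotheses.** (i) $\mathcal D:=\{(\rho,\theta)\in\mathbb R^2:\rho>\overline C_0,\ \theta>\overline C_1\}$ for fixed but arbitrary constants $\overline C_0,\overline C_1>0$, and $\mathcal U:=\{(\rho,u,\theta)\in\mathbb R^3:(\rho,\theta)\in\mathcal D\}$. (ii) The fluid has Helmholtz free energy $\Psi=\psi(\rho,\theta)+\kappa(\rho,\theta)\rho_x^2$ with $\psi,\kappa\in C^\infty(\overline{\mathcal D})$, $\kappa>0$; its specific entropy is $-\Psi_\theta=\eta-\kappa_\theta\rho_x^2$ and its internal energy is the $\varepsilon$ above; $\mu,\alpha\in C^\infty(\overline{\mathcal D})$ are functions of $(\rho,\theta)$ with $\mu>0$, $\alpha>0$.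 (iii) $p=\rho^2\psi_\rho$, $e=\psi-\theta\psi_\theta$, $\eta=-\psi_\theta$ belong to $C^\infty(\overline{\mathcal D})$, satisfy $de=\theta\,d\eta-p\,d(1/\rho)$ and $p>0$, $p_\rho>0$, $p_\theta>0$, $e_\theta>0$ on $\mathcal D$; consequently $e_\rho=\rho^{-2}(p-\theta p_\theta)$, $\eta_\theta=e_\theta/\theta$, $\eta_\rho=-p_\theta/\rho^2$ on $\mathcal D$. (iv) $\kappa_{\theta\theta}\le0$ on $\mathcal D$. **Function space.** For $T>0$, $M_i\ge m_i>0$, $s\ge3$, $X_s((0,T);m_1,M_1,m_2,M_2)$ is the set of $(\rho,u,\theta)$ with $\rho-\overline\rho\in C((0,T);H^{s+1}(\mathbb R))\cap C^1((0,T);H^{s-1}(\mathbb R))$, $(u-\overline u,\theta-\overline\theta)\in C((0,T);H^s\times H^s)\cap C^1((0,T);H^{s-2}\times H^{s-2})$, $(\rho_x,u_x,\theta_x)\in L^2((0,T);H^{s+1}\times H^s\times H^s)$, and $m_1\le\rho\le M_1$, $m_2\le\theta\le M_2$ a.e. in $\mathbb R\times(0,T)$. **Local existence theorem (known).** Let $\rho_0-\overline\rho\in H^{s+1}(\mathbb R)$, $(u_0-\overline u,\theta_0-\overline\theta)\in H^s(\mathbb R)^2$, $s\ge3$. There is $a_0>0$ such that if $\big(\|\rho_0-\overline\rho\|_{s+1}^2+\|u_0-\overline u\|_s^2+\|\theta_0-\overline\theta\|_s^2\big)^{1/2}<a_0$ (with $\|\cdot\|_s$ the $H^s(\mathbb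 R)$ norm), then $m_1\le\rho_0\le M_1$, $m_2\le\theta_0\le M_2$ a.e. for some constants $M_i\ge m_i>0$, and there is $T_1=T_1(a_0)>0$ such that the Cauchy problem for the system with initial data $(\rho_0,u_0,\theta_0)$ has a unique smooth solution in $X_s((0,T_1);\tfrac12m_1,2M_1,\tfrac12m_2,2M_2)$. *)

theory Defs
  imports "HOL-Analysis.Analysis"
begin

section \<open>Functions of two real variables\<close>

text \<open>Both the constitutive functions of \<open>(\<rho>,\<theta>)\<close> and the unknowns, as functions of
  \<open>(x,t)\<close>, are curried, so \<open>pd1\<close>, \<open>pd2\<close> stand for \<open>\<partial>\<^sub>\<rho>, \<partial>\<^sub>\<theta>\<close> in the first case and for
  \<open>\<partial>\<^sub>x, \<partial>\<^sub>t\<close> in the second.\<close>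

definition pd1 :: "(real \<Rightarrow> real \<Rightarrow> real) \<Rightarrow> real \<Rightarrow> real \<Rightarrow> real" where
  "pd1 f a b = deriv (\<lambda>y. f y b) a"

definition pd2 :: "(real \<Rightarrow> real \<Rightarrow> real) \<Rightarrow> real \<Rightarrow> real \<Rightarrow> real" where
  "pd2 f a b = deriv (\<lambda>y. f a y) b"

text \<open>\<open>C\<^sup>k\<close> up to the boundary of an open set \<open>D\<close>: all partial derivatives of order at most \<open>k\<close>
  exist in \<open>D\<close> and extend continuously to \<open>closure D\<close>. Only the values of \<open>f\<close> in \<open>D\<close> matter; on the
  boundary the function is its continuous extension.\<close>

primrec Ck_closure :: "nat \<Rightarrow> (real \<times> real) set \<Rightarrow> (real \<Rightarrow> real \<Rightarrow> real) \<Rightarrow> bool" where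
  "Ck_closure 0 D f \<longleftrightarrow>
     (\<exists>g. continuous_on (closure D) g \<and> (\<forall>(a, b)\<in>D. g (a, b) = f a b))"
| "Ck_closure (Suc k) D f \<longleftrightarrow>
     (\<exists>g. continuous_on (closure D) g \<and> (\<forall>(a, b)\<in>D. g (a, b) = f a b)) \<and>
     (\<forall>(a, b)\<in>D. (\<lambda>y. f y b) differentiable (at a) \<and> (\<lambda>y. f a y) differentiable (at b)) \<and>
     Ck_closure k D (pd1 f) \<and> Ck_closure k D (pd2 f)"

definition smooth_closure :: "(real \<times> real) set \<Rightarrow> (real \<Rightarrow> real \<Rightarrow> real) \<Rightarrow> bool" where
  "smooth_closure D f \<longleftrightarrow> (\<forall>k. Ck_closure k D f)"


section \<open>Sobolev spaces on the real line\<close>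

definition square_integrable :: "(real \<Rightarrow> real) \<Rightarrow> bool" where
  "square_integrable f \<longleftrightarrow>
     f \<in> borel_measurable lebesgue \<and> integrable lebesgue (\<lambda>x. (f x)\<^sup>2)"

text \<open>The (unitary) Fourier--Plancherel transform of \<open>f \<in> L\<^sup>2\<close>: the \<open>L\<^sup>2\<close> limit of the transforms of
  the truncations of \<open>f\<close>. It is determined up to null sets, whence the choice operator.\<close>

definition truncated_fourier :: "(real \<Rightarrow> real) \<Rightarrow> real \<Rightarrow> real \<Rightarrow> complex" where
  "truncated_fourier f R \<xi> =
     (LINT x:{-R..R}|lebesgue. exp (- \<i> * of_real (x * \<xi>)) * of_real (f x)) / of_real (sqrt (2 * pi))"

definition plancherel :: "(real \<Rightarrow> real) \<Rightarrow> real \<Rightarrow> complex" where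
  "plancherel f = (SOME g. g \<in> borel_measurable lebesgue \<and>
     ((\<lambda>R. \<integral>\<^sup>+\<xi>. ennreal ((cmod (truncated_fourier f R \<xi> - g \<xi>))\<^sup>2) \<partial>lebesgue) \<longlongrightarrow> 0) at_top)"

text \<open>\<open>H\<^sup>s(\<real>)\<close> for real \<open>s \<ge> 0\<close>. The exponent \<open>s\<close> need not be an integer.\<close>

definition sobolev :: "real \<Rightarrow> (real \<Rightarrow> real) set" where
  "sobolev s = {f. square_integrable f \<and>
     integrable lebesgue (\<lambda>\<xi>. (1 + \<xi>\<^sup>2) powr s * (cmod (plancherel f \<xi>))\<^sup>2)}"

definition sobolev_norm :: "real \<Rightarrow> (real \<Rightarrow> real) \<Rightarrow> real" where
  "sobolev_norm s f =
     sqrt (LINT \<xi>|lebesgue. (1 + \<xi>\<^sup>2) powr s * (cmod (plancherel f \<xi>))\<^sup>2)"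

definition test_function :: "(real \<Rightarrow> real) \<Rightarrow> bool" where
  "test_function \<phi> \<longleftrightarrow>
     (\<forall>n x. (deriv ^^ n) \<phi> differentiable (at x)) \<and> compact (closure {x. \<phi> x \<noteq> 0})"

definition weak_derivative :: "(real \<Rightarrow> real) \<Rightarrow> (real \<Rightarrow> real) \<Rightarrow> bool" where
  "weak_derivative f g \<longleftrightarrow>
     (\<forall>a b. set_integrable lebesgue {a..b} f \<and> set_integrable lebesgue {a..b} g) \<and>
     (\<forall>\<phi>. test_function \<phi> \<longrightarrow>
        (LINT x|lebesgue. f x * deriv \<phi> x) = - (LINT x|lebesgue. g x * \<phi> x))"


section \<open>Functions of time with values in a Sobolev space\<close>

text \<open>Here \<open>F t\<close> is the function of \<open>x\<close> at time \<open>t\<close>.\<close>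

definition C0_sobolev :: "real set \<Rightarrow> real \<Rightarrow> (real \<Rightarrow> real \<Rightarrow> real) \<Rightarrow> bool" where
  "C0_sobolev I r F \<longleftrightarrow>
     (\<forall>t\<in>I. F t \<in> sobolev r \<and>
        ((\<lambda>\<tau>. sobolev_norm r (\<lambda>x. F \<tau> x - F t x)) \<longlongrightarrow> 0) (at t within I))"

definition C1_sobolev :: "real set \<Rightarrow> real \<Rightarrow> (real \<Rightarrow> real \<Rightarrow> real) \<Rightarrow> bool" where
  "C1_sobolev I r F \<longleftrightarrow>
     C0_sobolev I r F \<and>
     (\<exists>F'. C0_sobolev I r F' \<and>
        (\<forall>t\<in>I. ((\<lambda>\<tau>. sobolev_norm r (\<lambda>x. (F \<tau> x - F t x) / (\<tau> - t) - F' t x)) \<longlongrightarrow> 0)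
                 (at t within I)))"

text \<open>Strong (Bochner) measurability: almost everywhere limit of simple functions.\<close>

definition strongly_measurable_sobolev ::
    "real set \<Rightarrow> real \<Rightarrow> (real \<Rightarrow> real \<Rightarrow> real) \<Rightarrow> bool" where
  "strongly_measurable_sobolev I r F \<longleftrightarrow>
     (\<exists>S :: nat \<Rightarrow> real \<Rightarrow> real \<Rightarrow> real.
        (\<forall>n. finite (range (S n)) \<and> range (S n) \<subseteq> sobolev r \<and>
             (\<forall>h. {t\<in>I. S n t = h} \<in> sets lebesgue)) \<and>
        (AE t in lebesgue. t \<in> I \<longrightarrow>
             (\<lambda>n. sobolev_norm r (\<lambda>x. S n t x - F t x)) \<longlonglongrightarrow> 0))"

definition L2_sobolev :: "real set \<Rightarrow> real \<Rightarrow> (real \<Rightarrow> real \<Rightarrow> real) \<Rightarrow> bool" where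
  "L2_sobolev I r F \<longleftrightarrow>
     (AE t in lebesgue. t \<in> I \<longrightarrow> F t \<in> sobolev r) \<and>
     strongly_measurable_sobolev I r F \<and>
     set_integrable lebesgue I (\<lambda>t. (sobolev_norm r (F t))\<^sup>2)"

definition x_derivative_in_L2_sobolev ::
    "real set \<Rightarrow> real \<Rightarrow> (real \<Rightarrow> real \<Rightarrow> real) \<Rightarrow> bool" where
  "x_derivative_in_L2_sobolev I r F \<longleftrightarrow>
     (\<exists>G. (AE t in lebesgue. t \<in> I \<longrightarrow> weak_derivative (F t) (G t)) \<and> L2_sobolev I r G)"

text \<open>The space \<open>X\<^sub>s((0,T); m\<^sub>1, M\<^sub>1, m\<^sub>2, M\<^sub>2)\<close> around the constant state \<open>(\<rho>b, ub, \<theta>b)\<close>; an element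
  consists of three functions of \<open>(x,t)\<close>.\<close>

definition Xs ::
    "real \<times> real \<times> real \<Rightarrow> real \<Rightarrow> real \<Rightarrow> real \<Rightarrow> real \<Rightarrow> real \<Rightarrow> real \<Rightarrow>
     ((real \<Rightarrow> real \<Rightarrow> real) \<times> (real \<Rightarrow> real \<Rightarrow> real) \<times> (real \<Rightarrow> real \<Rightarrow> real)) set" where
  "Xs Ub s T m1 M1 m2 M2 = (case Ub of (\<rho>b, ub, \<theta>b) \<Rightarrow> {(\<rho>, u, \<theta>).
     C0_sobolev {0<..<T} (s + 1) (\<lambda>t x. \<rho> x t - \<rho>b) \<and>
     C1_sobolev {0<..<T} (s - 1) (\<lambda>t x. \<rho> x t - \<rho>b) \<and>
     C0_sobolev {0<..<T} s (\<lambda>t x. u x t - ub) \<and>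
     C1_sobolev {0<..<T} (s - 2) (\<lambda>t x. u x t - ub) \<and>
     C0_sobolev {0<..<T} s (\<lambda>t x. \<theta> x t - \<theta>b) \<and>
     C1_sobolev {0<..<T} (s - 2) (\<lambda>t x. \<theta> x t - \<theta>b) \<and>
     x_derivative_in_L2_sobolev {0<..<T} (s + 1) (\<lambda>t x. \<rho> x t) \<and>
     x_derivative_in_L2_sobolev {0<..<T} s (\<lambda>t x. u x t) \<and>
     x_derivative_in_L2_sobolev {0<..<T} s (\<lambda>t x. \<theta> x t) \<and>
     (AE (x, t) in (lebesgue :: (real \<times> real) measure). t \<in> {0<..<T} \<longrightarrow>
        m1 \<le> \<rho> x t \<and> \<rho> x t \<le> M1 \<and> m2 \<le> \<theta> x t \<and> \<theta> x t \<le> M2)})"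


section \<open>The fluid\<close>

text \<open>The fluid is given by its Helmholtz free energy \<open>\<psi>(\<rho>,\<theta>) + \<kappa>(\<rho>,\<theta>) \<rho>\<^sub>x\<^sup>2\<close>, its viscosity \<open>\<mu>\<close>
  and its heat conductivity \<open>\<alpha>\<close>, all as functions of \<open>(\<rho>,\<theta>)\<close>. Below, \<open>q\<close> stands for \<open>\<rho>\<^sub>x\<close>.\<close>

record fluid =
  psi :: "real \<Rightarrow> real \<Rightarrow> real"
  kappa :: "real \<Rightarrow> real \<Rightarrow> real"
  mu :: "real \<Rightarrow> real \<Rightarrow> real"
  alpha :: "real \<Rightarrow> real \<Rightarrow> real"

definition phase_domain :: "real \<Rightarrow> real \<Rightarrow> (real \<times> real) set" where
  "phase_domain C0 C1 = {(r, \<theta>). r > C0 \<and> \<theta> > C1}"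

definition state_domain :: "real \<Rightarrow> real \<Rightarrow> (real \<times> real \<times> real) set" where
  "state_domain C0 C1 = {(r, u, \<theta>). (r, \<theta>) \<in> phase_domain C0 C1}"

definition helmholtz :: "fluid \<Rightarrow> real \<Rightarrow> real \<Rightarrow> real \<Rightarrow> real" where
  "helmholtz F r \<theta> q = psi F r \<theta> + kappa F r \<theta> * q\<^sup>2"

definition pressure :: "fluid \<Rightarrow> real \<Rightarrow> real \<Rightarrow> real" where
  "pressure F r \<theta> = r\<^sup>2 * pd1 (psi F) r \<theta>"

definition e_fun :: "fluid \<Rightarrow> real \<Rightarrow> real \<Rightarrow> real" where
  "e_fun F r \<theta> = psi F r \<theta> - \<theta> * pd2 (psi F) r \<theta>"

definition eta_fun :: "fluid \<Rightarrow> real \<Rightarrow> real \<Rightarrow> real" where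
  "eta_fun F r \<theta> = - pd2 (psi F) r \<theta>"

definition specific_entropy :: "fluid \<Rightarrow> real \<Rightarrow> real \<Rightarrow> real \<Rightarrow> real" where
  "specific_entropy F r \<theta> q = - deriv (\<lambda>y. helmholtz F r y q) \<theta>"

definition internal_energy :: "fluid \<Rightarrow> real \<Rightarrow> real \<Rightarrow> real \<Rightarrow> real" where
  "internal_energy F r \<theta> q =
     e_fun F r \<theta> + (kappa F r \<theta> - \<theta> * pd2 (kappa F) r \<theta>) * q\<^sup>2"

definition k_fun :: "fluid \<Rightarrow> real \<Rightarrow> real \<Rightarrow> real" where
  "k_fun F r \<theta> = 2 * r * kappa F r \<theta>"

lemma specific_entropy_eq:
  assumes "smooth_closure D (psi F)" "smooth_closure D (kappa F)" "(r, \<theta>) \<in> D"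
  shows "specific_entropy F r \<theta> q = eta_fun F r \<theta> - pd2 (kappa F) r \<theta> * q\<^sup>2"
proof -
  have "Ck_closure (Suc 0) D (psi F)" "Ck_closure (Suc 0) D (kappa F)"
    using assms(1,2) unfolding smooth_closure_def by blast+
  then have d: "(\<lambda>y. psi F r y) differentiable (at \<theta>)" "(\<lambda>y. kappa F r y) differentiable (at \<theta>)"
    using assms(3) by auto
  have "((\<lambda>y. psi F r y) has_field_derivative pd2 (psi F) r \<theta>) (at \<theta>)"
    "((\<lambda>y. kappa F r y) has_field_derivative pd2 (kappa F) r \<theta>) (at \<theta>)"
    using d unfolding pd2_def by (simp_all add: DERIV_deriv_iff_real_differentiable)
  then have "((\<lambda>y. helmholtz F r y q) has_field_derivative
      pd2 (psi F) r \<theta> + pd2 (kappa F) r \<theta> * q\<^sup>2) (at \<theta>)"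
    unfolding helmholtz_def by (auto intro!: derivative_eq_intros)
  then show ?thesis
    unfolding specific_entropy_def eta_fun_def by (simp add: DERIV_imp_deriv)
qed

lemma internal_energy_eq:
  assumes "smooth_closure D (psi F)" "smooth_closure D (kappa F)" "(r, \<theta>) \<in> D"
  shows "internal_energy F r \<theta> q = helmholtz F r \<theta> q + \<theta> * specific_entropy F r \<theta> q"
  unfolding specific_entropy_eq[OF assms]
  by (simp add: internal_energy_def helmholtz_def e_fun_def eta_fun_def algebra_simps)

text \<open>\<open>de = \<theta> d\<eta> - p d(1/\<rho>)\<close> as an identity between differentials in \<open>(\<rho>,\<theta>)\<close>.\<close>

definition gibbs_relation :: "fluid \<Rightarrow> real \<Rightarrow> real \<Rightarrow> bool" where
  "gibbs_relation F r \<theta> \<longleftrightarrow> (\<forall>h.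
     frechet_derivative (\<lambda>(a, b). e_fun F a b) (at (r, \<theta>)) h =
     \<theta> * frechet_derivative (\<lambda>(a, b). eta_fun F a b) (at (r, \<theta>)) h
     - pressure F r \<theta> * frechet_derivative (\<lambda>(a, b). 1 / a) (at (r, \<theta>)) h)"

definition free_energy_hyp :: "(real \<times> real) set \<Rightarrow> fluid \<Rightarrow> bool" where
  "free_energy_hyp D F \<longleftrightarrow>
     smooth_closure D (psi F) \<and> smooth_closure D (kappa F) \<and>
     smooth_closure D (mu F) \<and> smooth_closure D (alpha F) \<and>
     (\<forall>(r, \<theta>)\<in>D. kappa F r \<theta> > 0 \<and> mu F r \<theta> > 0 \<and> alpha F r \<theta> > 0)"

definition thermodynamic_hyp :: "(real \<times> real) set \<Rightarrow> fluid \<Rightarrow> bool" where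
  "thermodynamic_hyp D F \<longleftrightarrow>
     smooth_closure D (pressure F) \<and> smooth_closure D (e_fun F) \<and> smooth_closure D (eta_fun F) \<and>
     (\<forall>(r, \<theta>)\<in>D. gibbs_relation F r \<theta> \<and>
        pressure F r \<theta> > 0 \<and> pd1 (pressure F) r \<theta> > 0 \<and> pd2 (pressure F) r \<theta> > 0 \<and>
        pd2 (e_fun F) r \<theta> > 0)"

definition kappa_concave_hyp :: "(real \<times> real) set \<Rightarrow> fluid \<Rightarrow> bool" where
  "kappa_concave_hyp D F \<longleftrightarrow> (\<forall>(r, \<theta>)\<in>D. pd2 (pd2 (kappa F)) r \<theta> \<le> 0)"


section \<open>The Navier--Stokes--Fourier--Korteweg system\<close>

text \<open>The unknowns \<open>\<rho>, u, \<theta>\<close> are functions of \<open>(x,t)\<close>. Note that \<open>k\<^sub>x\<close> is the derivative of the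
  composition \<open>k(\<rho>(x,t),\<theta>(x,t))\<close>, while \<open>k\<^sub>\<rho>\<close> is the partial derivative of \<open>k\<close> evaluated there.\<close>

definition korteweg_K ::
    "fluid \<Rightarrow> (real \<Rightarrow> real \<Rightarrow> real) \<Rightarrow> (real \<Rightarrow> real \<Rightarrow> real) \<Rightarrow> real \<Rightarrow> real \<Rightarrow> real" where
  "korteweg_K F \<rho> \<theta> x t =
     k_fun F (\<rho> x t) (\<theta> x t) * \<rho> x t * pd1 (pd1 \<rho>) x t
     + \<rho> x t * pd1 (\<lambda>y \<tau>. k_fun F (\<rho> y \<tau>) (\<theta> y \<tau>)) x t * pd1 \<rho> x t
     - 1/2 * pd1 (k_fun F) (\<rho> x t) (\<theta> x t) * \<rho> x t * (pd1 \<rho> x t)\<^sup>2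
     - 1/2 * k_fun F (\<rho> x t) (\<theta> x t) * (pd1 \<rho> x t)\<^sup>2"

definition interstitial_work ::
    "fluid \<Rightarrow> (real \<Rightarrow> real \<Rightarrow> real) \<Rightarrow> (real \<Rightarrow> real \<Rightarrow> real) \<Rightarrow> (real \<Rightarrow> real \<Rightarrow> real) \<Rightarrow>
     real \<Rightarrow> real \<Rightarrow> real" where
  "interstitial_work F \<rho> u \<theta> x t =
     - k_fun F (\<rho> x t) (\<theta> x t) * \<rho> x t * pd1 \<rho> x t * pd1 u x t"

definition mass_eq ::
    "(real \<Rightarrow> real \<Rightarrow> real) \<Rightarrow> (real \<Rightarrow> real \<Rightarrow> real) \<Rightarrow> real \<Rightarrow> real \<Rightarrow> bool" where
  "mass_eq \<rho> u x t \<longleftrightarrow> pd2 \<rho> x t + pd1 (\<lambda>y \<tau>. \<rho> y \<tau> * u y \<tau>) x t = 0"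

definition momentum_eq ::
    "fluid \<Rightarrow> (real \<Rightarrow> real \<Rightarrow> real) \<Rightarrow> (real \<Rightarrow> real \<Rightarrow> real) \<Rightarrow> (real \<Rightarrow> real \<Rightarrow> real) \<Rightarrow>
     real \<Rightarrow> real \<Rightarrow> bool" where
  "momentum_eq F \<rho> u \<theta> x t \<longleftrightarrow>
     pd2 (\<lambda>y \<tau>. \<rho> y \<tau> * u y \<tau>) x t
     + pd1 (\<lambda>y \<tau>. \<rho> y \<tau> * (u y \<tau>)\<^sup>2 + pressure F (\<rho> y \<tau>) (\<theta> y \<tau>)) x t
     = pd1 (\<lambda>y \<tau>. mu F (\<rho> y \<tau>) (\<theta> y \<tau>) * pd1 u y \<tau> + korteweg_K F \<rho> \<theta> y \<tau>) x t"

definition energy_eq ::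
    "fluid \<Rightarrow> (real \<Rightarrow> real \<Rightarrow> real) \<Rightarrow> (real \<Rightarrow> real \<Rightarrow> real) \<Rightarrow> (real \<Rightarrow> real \<Rightarrow> real) \<Rightarrow>
     real \<Rightarrow> real \<Rightarrow> bool" where
  "energy_eq F \<rho> u \<theta> x t \<longleftrightarrow>
     (let \<epsilon> = (\<lambda>y \<tau>. internal_energy F (\<rho> y \<tau>) (\<theta> y \<tau>) (pd1 \<rho> y \<tau>)) in
      pd2 (\<lambda>y \<tau>. \<rho> y \<tau> * \<epsilon> y \<tau> + 1/2 * \<rho> y \<tau> * (u y \<tau>)\<^sup>2) x t
      + pd1 (\<lambda>y \<tau>. \<rho> y \<tau> * u y \<tau> * (\<epsilon> y \<tau> + 1/2 * (u y \<tau>)\<^sup>2)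
                   + pressure F (\<rho> y \<tau>) (\<theta> y \<tau>) * u y \<tau>) x t
      = pd1 (\<lambda>y \<tau>. alpha F (\<rho> y \<tau>) (\<theta> y \<tau>) * pd1 \<theta> y \<tau>
                   + mu F (\<rho> y \<tau>) (\<theta> y \<tau>) * u y \<tau> * pd1 u y \<tau>
                   + u y \<tau> * korteweg_K F \<rho> \<theta> y \<tau>
                   + interstitial_work F \<rho> u \<theta> y \<tau>) x t)"

text \<open>A classical solution on \<open>(0,T)\<close>. Elements of \<open>Xs\<close> with \<open>s \<ge> 3\<close> are represented by
  functions having all the derivatives listed here (Sobolev embedding). The equations are imposed for
  almost every \<open>x\<close>, as the constitutive functions are only meaningful where \<open>(\<rho>,\<theta>)\<close> lies in
  the phase domain.\<close>

definition classical_solution ::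
    "fluid \<Rightarrow> real \<Rightarrow> (real \<Rightarrow> real \<Rightarrow> real) \<Rightarrow> (real \<Rightarrow> real \<Rightarrow> real) \<Rightarrow> (real \<Rightarrow> real \<Rightarrow> real) \<Rightarrow>
     bool" where
  "classical_solution F T \<rho> u \<theta> \<longleftrightarrow> (\<forall>t\<in>{0<..<T}.
     (\<forall>x. (\<forall>f\<in>{\<rho>, u, \<theta>, pd1 \<rho>}. (\<lambda>\<tau>. f x \<tau>) differentiable (at t)) \<and>
          (\<forall>f\<in>{\<rho>, pd1 \<rho>, pd1 (pd1 \<rho>), u, pd1 u, \<theta>, pd1 \<theta>}.
             (\<lambda>y. f y t) differentiable (at x))) \<and>
     (AE x in lebesgue. mass_eq \<rho> u x t \<and> momentum_eq F \<rho> u \<theta> x t \<and> energy_eq F \<rho> u \<theta> x t))"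

text \<open>The initial value is the value at \<open>t = 0\<close>, and it is attained in \<open>L\<^sup>2\<close> (the norm of \<open>H\<^sup>0\<close>)
  as \<open>t\<close> decreases to \<open>0\<close>.\<close>

definition initial_value :: "(real \<Rightarrow> real \<Rightarrow> real) \<Rightarrow> (real \<Rightarrow> real) \<Rightarrow> bool" where
  "initial_value f f0 \<longleftrightarrow>
     (AE x in lebesgue. f x 0 = f0 x) \<and>
     ((\<lambda>t. sobolev_norm 0 (\<lambda>x. f x t - f0 x)) \<longlongrightarrow> 0) (at_right 0)"

definition cauchy_solution ::
    "fluid \<Rightarrow> real \<Rightarrow> (real \<Rightarrow> real) \<times> (real \<Rightarrow> real) \<times> (real \<Rightarrow> real) \<Rightarrow>
     (real \<Rightarrow> real \<Rightarrow> real) \<times> (real \<Rightarrow> real \<Rightarrow> real) \<times> (real \<Rightarrow> real \<Rightarrow> real) \<Rightarrow> bool" where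
  "cauchy_solution F T = (\<lambda>(\<rho>0, u0, \<theta>0) (\<rho>, u, \<theta>).
     classical_solution F T \<rho> u \<theta> \<and>
     initial_value \<rho> \<rho>0 \<and> initial_value u u0 \<and> initial_value \<theta> \<theta>0)"

text \<open>The hypotheses on the initial data in the local existence theorem, with threshold \<open>a0\<close>, together
  with the bounds by \<open>m\<^sub>i, M\<^sub>i\<close>.\<close>

definition admissible_data ::
    "real \<times> real \<times> real \<Rightarrow> real \<Rightarrow> real \<Rightarrow> real \<Rightarrow> real \<Rightarrow> real \<Rightarrow> real \<Rightarrow>
     (real \<Rightarrow> real) \<times> (real \<Rightarrow> real) \<times> (real \<Rightarrow> real) \<Rightarrow> bool" where
  "admissible_data Ub s a0 m1 M1 m2 M2 = (\<lambda>(\<rho>0, u0, \<theta>0). case Ub of (\<rho>b, ub, \<theta>b) \<Rightarrow>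
     (\<lambda>x. \<rho>0 x - \<rho>b) \<in> sobolev (s + 1) \<and>
     (\<lambda>x. u0 x - ub) \<in> sobolev s \<and>
     (\<lambda>x. \<theta>0 x - \<theta>b) \<in> sobolev s \<and>
     sqrt ((sobolev_norm (s + 1) (\<lambda>x. \<rho>0 x - \<rho>b))\<^sup>2 + (sobolev_norm s (\<lambda>x. u0 x - ub))\<^sup>2
           + (sobolev_norm s (\<lambda>x. \<theta>0 x - \<theta>b))\<^sup>2) < a0 \<and>
     (AE x in lebesgue. m1 \<le> \<rho>0 x \<and> \<rho>0 x \<le> M1 \<and> m2 \<le> \<theta>0 x \<and> \<theta>0 x \<le> M2))"


section \<open>The conserved quantities\<close>

text \<open>\<open>F0 F U V\<close> with \<open>U = (\<rho>, u, \<theta>)\<close> and \<open>V\<close> in the place of \<open>U\<^sub>x\<close>, so that \<open>V $ 1\<close> is \<open>\<rho>\<^sub>x\<close>.\<close>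

definition F0 :: "fluid \<Rightarrow> real^3 \<Rightarrow> real^3 \<Rightarrow> real^3" where
  "F0 F U V = vector
     [U $ 1,
      U $ 1 * U $ 2,
      U $ 1 * (internal_energy F (U $ 1) (U $ 3) (V $ 1) + 1/2 * (U $ 2)\<^sup>2)]"

text \<open>Jacobian in \<open>U\<close> with \<open>V\<close> frozen.\<close>

definition DU_F0 :: "fluid \<Rightarrow> real^3 \<Rightarrow> real^3 \<Rightarrow> real^3^3" where
  "DU_F0 F U V = jacobian (\<lambda>W. F0 F W V) (at U)"

end

theory Submission
  imports Defs
begin

text \<open>The Jacobian is lower triangular with diagonal
  \<open>1, \<rho>, \<rho> \<epsilon>\<^sub>\<theta>\<close>, and \<open>\<epsilon>\<^sub>\<theta> = e\<^sub>\<theta> - \<theta> \<kappa>\<^sub>\<theta>\<^sub>\<theta> \<rho>\<^sub>x\<^sup>2 \<ge> e\<^sub>\<theta> > 0\<close> because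
  \<open>\<theta> > 0\<close> and \<open>\<kappa>\<^sub>\<theta>\<^sub>\<theta> \<le> 0\<close>.\<close>

lemma open_phase_domain: "open (phase_domain C0 C1)"
proof -
  have "phase_domain C0 C1 = {C0<..} \<times> {C1<..}"
    by (auto simp: phase_domain_def)
  then show ?thesis
    by (simp add: open_Times)
qed

lemma smooth_closure_pd:
  assumes "smooth_closure D f"
  shows "smooth_closure D (pd1 f)" and "smooth_closure D (pd2 f)"
proof -
  have "Ck_closure (Suc k) D f" for k
    using assms by (simp add: smooth_closure_def)
  then show "smooth_closure D (pd1 f)" and "smooth_closure D (pd2 f)"
    by (simp_all add: smooth_closure_def)
qed

text \<open>The continuous extension at order zero agrees with \<open>f\<close> on \<open>D\<close>,
  which gives continuity in both variables jointly. Applied to a partial derivative, this is what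
  makes Frechet differentiability available below.\<close>

lemma smooth_closure_continuous_on:
  assumes "smooth_closure D f"
  shows "continuous_on D (\<lambda>(a, b). f a b)"
proof -
  have "Ck_closure 0 D f"
    using assms unfolding smooth_closure_def by blast
  then obtain g where g: "continuous_on (closure D) g" "\<forall>(a, b)\<in>D. g (a, b) = f a b"
    by auto
  have "continuous_on D g"
    using g(1) closure_subset continuous_on_subset by blast
  then show ?thesis
    by (rule continuous_on_eq) (use g(2) in auto)
qed

lemma smooth_closure_has_pd:
  assumes "smooth_closure D f" and "(a, b) \<in> D"
  shows "((\<lambda>y. f y b) has_field_derivative pd1 f a b) (at a)"
    and "((\<lambda>y. f a y) has_field_derivative pd2 f a b) (at b)"
proof -
  have "Ck_closure (Suc 0) D f"
    using assms(1) unfolding smooth_closure_def by blast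
  then have "(\<lambda>y. f y b) differentiable (at a)" "(\<lambda>y. f a y) differentiable (at b)"
    using assms(2) by auto
  then show "((\<lambda>y. f y b) has_field_derivative pd1 f a b) (at a)"
    and "((\<lambda>y. f a y) has_field_derivative pd2 f a b) (at b)"
    unfolding pd1_def pd2_def by (simp_all add: DERIV_deriv_iff_real_differentiable)
qed

text \<open>\<open>Ck_closure\<close> speaks of separate partial derivatives only. Existence of the
  first partial at the point, together with existence of the second near it and joint continuity
  there, yields the total derivative.\<close>

lemma smooth_closure_has_derivative:
  assumes f: "smooth_closure D f" and "open D" and "(a, b) \<in> D"
  shows "((\<lambda>(x, y). f x y) has_derivative (\<lambda>(h, k). pd1 f a b * h + pd2 f a b * k)) (at (a, b))"
proof -
  obtain A B where AB: "open A" "open B" "(a, b) \<in> A \<times> B" "A \<times> B \<subseteq> D"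
    using assms(2,3) by (rule open_prod_elim)
  \<comment> \<open>The criterion for partial derivatives needs a convex set in the second variable,
    so \<open>B\<close> is shrunk to a ball.\<close>
  obtain e where e: "e > 0" "ball b e \<subseteq> B"
    using AB open_contains_ball by blast
  let ?Y = "ball b e"
  have sub: "A \<times> ?Y \<subseteq> D"
    using AB e by blast
  have "((\<lambda>(x, y). f x y) has_derivative
      (\<lambda>(h, k). pd1 f a b * h + blinfun_scaleR_left (pd2 f a b) k)) (at (a, b) within A \<times> ?Y)"
  proof (rule has_derivative_partialsI[where fy = "\<lambda>x y. blinfun_scaleR_left (pd2 f x y)"])
    show "((\<lambda>x. f x b) has_derivative (\<lambda>h. pd1 f a b * h)) (at a within A)"
      using smooth_closure_has_pd(1)[OF f assms(3)]
      by (simp add: has_field_derivative_def has_derivative_at_withinI)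
    show "((\<lambda>y. f x y) has_derivative blinfun_scaleR_left (pd2 f x y)) (at y within ?Y)"
      if "x \<in> A" "y \<in> ?Y" for x y
    proof -
      have "(x, y) \<in> D" using that sub by blast
      from smooth_closure_has_pd(2)[OF f this] show ?thesis
        by (simp add: has_field_derivative_def has_derivative_at_withinI mult_commute_abs)
    qed
    have "continuous_on D (\<lambda>(x, y). pd2 f x y)"
      by (rule smooth_closure_continuous_on[OF smooth_closure_pd(2)[OF f]])
    then have "continuous_on (A \<times> ?Y) (\<lambda>(x, y). pd2 f x y)"
      using sub continuous_on_subset by blast
    \<comment> \<open>The criterion takes the second partial as a bounded linear map; a number is
      sent continuously to multiplication by it.\<close>
    then have "continuous_on (A \<times> ?Y)
        (\<lambda>(x, y). blinfun_scaleR_left (pd2 f x y) :: real \<Rightarrow>\<^sub>L real)"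
      unfolding case_prod_beta
      by (rule bounded_linear.continuous_on[OF bounded_linear_blinfun_scaleR_left])
    then show "continuous (at (a, b) within A \<times> ?Y) (\<lambda>(x, y). blinfun_scaleR_left (pd2 f x y))"
      using AB e by (auto simp: continuous_on_eq_continuous_within)
  qed (use AB e in auto)
  moreover have "at (a, b) within A \<times> ?Y = at (a, b)"
    using AB e by (intro at_within_open open_Times) auto
  ultimately show ?thesis
    by (simp only: blinfun_scaleR_left.rep_eq real_scaleR_def mult.commute[of _ "pd2 f a b"])
qed

lemma smooth_closure_has_derivative_vec:
  fixes U :: "real^'n"
  assumes "smooth_closure D f" and "open D" and "(U $ i, U $ j) \<in> D"
  shows "((\<lambda>W. f (W $ i) (W $ j)) has_derivative
    (\<lambda>h. pd1 f (U $ i) (U $ j) * h $ i + pd2 f (U $ i) (U $ j) * h $ j)) (at U)"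
proof -
  have "((\<lambda>W. (W $ i, W $ j)) has_derivative (\<lambda>h. (h $ i, h $ j))) (at U)"
    by (intro has_derivative_Pair bounded_linear_imp_has_derivative bounded_linear_vec_nth)
  from has_derivative_compose[OF this smooth_closure_has_derivative[OF assms]]
  show ?thesis by simp
qed

text \<open>In this form a vector-valued map is differentiated by the rules for sums and scalar
  multiples.\<close>

lemma vector_3_eq_axis:
  "(vector [a, b, c] :: real^3) = a *\<^sub>R axis 1 1 + b *\<^sub>R axis 2 1 + c *\<^sub>R axis 3 1"
  by (simp add: vec_eq_iff forall_3 axis_def)

lemma has_derivative_vector_3:
  fixes f g h :: "'a::real_normed_vector \<Rightarrow> real"
  assumes "(f has_derivative f') F" "(g has_derivative g') F" "(h has_derivative h') F"
  shows "((\<lambda>x. vector [f x, g x, h x] :: real^3) has_derivative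
    (\<lambda>x. vector [f' x, g' x, h' x])) F"
  unfolding vector_3_eq_axis
  by (intro has_derivative_add has_derivative_scaleR_left assms)

text \<open>The constant \<open>c\<close> is the entry of the Jacobian in row 3, column 1. It lies
  below the diagonal, so its value is left unspecified.\<close>

lemma F0_has_derivative:
  assumes "smooth_closure D (kappa F)" and "smooth_closure D (e_fun F)"
    and "open D" and "(U $ 1, U $ 3) \<in> D"
  obtains c where "((\<lambda>W. F0 F W V) has_derivative
    (\<lambda>h. vector [h $ 1, U $ 1 * h $ 2 + h $ 1 * U $ 2,
      c * h $ 1 + U $ 1 * U $ 2 * h $ 2
      + U $ 1 * (pd2 (e_fun F) (U $ 1) (U $ 3)
                  - U $ 3 * pd2 (pd2 (kappa F)) (U $ 1) (U $ 3) * (V $ 1)\<^sup>2) * h $ 3])) (at U)"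
proof
  let ?r = "U $ 1" and ?\<theta> = "U $ 3" and ?q = "V $ 1"
  note d = smooth_closure_has_derivative_vec[OF _ assms(3,4)]
  note [derivative_intros] = d[OF assms(1)] d[OF assms(2)] d[OF smooth_closure_pd(2)[OF assms(1)]]
    bounded_linear_imp_has_derivative[OF bounded_linear_vec_nth]
  have "((\<lambda>W. W $ 1 * (internal_energy F (W $ 1) (W $ 3) ?q + 1/2 * (W $ 2)\<^sup>2)) has_derivative
    (\<lambda>h. (internal_energy F ?r ?\<theta> ?q + 1/2 * (U $ 2)\<^sup>2
          + ?r * (pd1 (e_fun F) ?r ?\<theta>
                  + (pd1 (kappa F) ?r ?\<theta> - ?\<theta> * pd1 (pd2 (kappa F)) ?r ?\<theta>) * ?q\<^sup>2)) * h $ 1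
      + ?r * U $ 2 * h $ 2
      + ?r * (pd2 (e_fun F) ?r ?\<theta> - ?\<theta> * pd2 (pd2 (kappa F)) ?r ?\<theta> * ?q\<^sup>2) * h $ 3)) (at U)"
    unfolding internal_energy_def
    \<comment> \<open>In the \<theta>-derivative of \<kappa> - \<theta> \<kappa>_\<theta> the two
      terms \<kappa>_\<theta> cancel, leaving -\<theta> \<kappa>_\<theta>\<theta>.\<close>
    by (rule derivative_eq_intros refl)+ (simp add: fun_eq_iff algebra_simps power2_eq_square)
  \<comment> \<open>The coefficient of \<open>h $ 1\<close> in the third component is the witness
    for \<open>c\<close>.\<close>
  then show "((\<lambda>W. F0 F W V) has_derivative
    (\<lambda>h. vector [h $ 1, ?r * h $ 2 + h $ 1 * U $ 2,
      (internal_energy F ?r ?\<theta> ?q + 1/2 * (U $ 2)\<^sup>2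
          + ?r * (pd1 (e_fun F) ?r ?\<theta>
                  + (pd1 (kappa F) ?r ?\<theta> - ?\<theta> * pd1 (pd2 (kappa F)) ?r ?\<theta>) * ?q\<^sup>2)) * h $ 1
      + ?r * U $ 2 * h $ 2
      + ?r * (pd2 (e_fun F) ?r ?\<theta> - ?\<theta> * pd2 (pd2 (kappa F)) ?r ?\<theta> * ?q\<^sup>2) * h $ 3])) (at U)"
    unfolding F0_def by (intro has_derivative_vector_3) (auto intro!: derivative_eq_intros)
qed

text \<open>Differentiability is part of the conclusion because \<open>jacobian\<close> is the
  matrix of a chosen derivative and is meaningful only where one exists.\<close>

lemma DU_F0_invertible:
  assumes "C0 > 0" and "C1 > 0"
    and free: "free_energy_hyp (phase_domain C0 C1) F"
    and thermo: "thermodynamic_hyp (phase_domain C0 C1) F"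
    and conc: "kappa_concave_hyp (phase_domain C0 C1) F"
    and U: "(U $ 1, U $ 3) \<in> phase_domain C0 C1"
  shows "(\<lambda>W. F0 F W V) differentiable (at U) \<and> invertible (DU_F0 F U V)"
proof -
  define E where "E = pd2 (e_fun F) (U $ 1) (U $ 3)
    - U $ 3 * pd2 (pd2 (kappa F)) (U $ 1) (U $ 3) * (V $ 1)\<^sup>2"
  have pos: "U $ 1 > 0" "U $ 3 > 0"
    using U assms(1,2) by (auto simp: phase_domain_def)
  have "pd2 (e_fun F) (U $ 1) (U $ 3) > 0" "pd2 (pd2 (kappa F)) (U $ 1) (U $ 3) \<le> 0"
    using thermo conc U by (auto simp: thermodynamic_hyp_def kappa_concave_hyp_def)
  then have "E > 0"
    using pos unfolding E_def
    by (smt (verit) mult_nonneg_nonpos mult_nonpos_nonneg zero_le_power2)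
  have "smooth_closure (phase_domain C0 C1) (kappa F)" "smooth_closure (phase_domain C0 C1) (e_fun F)"
    using free thermo by (auto simp: free_energy_hyp_def thermodynamic_hyp_def)
  then obtain c where der: "((\<lambda>W. F0 F W V) has_derivative
    (\<lambda>h. vector [h $ 1, U $ 1 * h $ 2 + h $ 1 * U $ 2,
      c * h $ 1 + U $ 1 * U $ 2 * h $ 2 + U $ 1 * E * h $ 3])) (at U)"
    (is "(_ has_derivative ?L) _")
    unfolding E_def by (rule F0_has_derivative[OF _ _ open_phase_domain U])
  then have diff: "(\<lambda>W. F0 F W V) differentiable (at U)"
    by (rule differentiableI)
  have J: "((\<lambda>W. F0 F W V) has_derivative (\<lambda>h. DU_F0 F U V *v h)) (at U)"
    using diff unfolding DU_F0_def jacobian_works .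
  \<comment> \<open>Uniqueness of the derivative identifies the abstract Jacobian with the explicit
    triangular map.\<close>
  have L: "DU_F0 F U V *v h = ?L h" for h
    by (rule fun_cong[OF has_derivative_unique[OF J der]])
  \<comment> \<open>Forward substitution: the rows give \<open>h $ 1 = 0\<close>, then
    \<open>h $ 2 = 0\<close> by \<rho> > 0, then \<open>h $ 3 = 0\<close> by \<rho> \<open>E\<close>
    > 0. A square matrix with trivial kernel is invertible.\<close>
  have "h = 0" if "DU_F0 F U V *v h = 0" for h
    using that pos \<open>E > 0\<close> unfolding L by (auto simp: vec_eq_iff forall_3)
  then have "invertible (DU_F0 F U V)"
    unfolding invertible_left_inverse matrix_left_invertible_ker by blast
  with diff show ?thesis ..
qed

theorem proposition3p1:
  fixes C0 C1 s a0 T T1 m1 M1 m2 M2 :: real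
    and F :: fluid
    and \<rho>b ub \<theta>b :: real
    and \<rho>0 u0 \<theta>0 :: "real \<Rightarrow> real"
    and \<rho> u \<theta> :: "real \<Rightarrow> real \<Rightarrow> real"
  assumes "C0 > 0" and "C1 > 0"
    and "free_energy_hyp (phase_domain C0 C1) F"
    and "thermodynamic_hyp (phase_domain C0 C1) F"
    and "kappa_concave_hyp (phase_domain C0 C1) F"
    and "(\<rho>b, ub, \<theta>b) \<in> state_domain C0 C1"
    and "s \<ge> 3"
    and "0 < m1" and "m1 \<le> M1" and "0 < m2" and "m2 \<le> M2"
    and "a0 > 0" and "admissible_data (\<rho>b, ub, \<theta>b) s a0 m1 M1 m2 M2 (\<rho>0, u0, \<theta>0)"
    and "0 < T" and "T \<le> T1"
    and "(\<rho>, u, \<theta>) \<in> Xs (\<rho>b, ub, \<theta>b) s T (m1 / 2) (2 * M1) (m2 / 2) (2 * M2)"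
    and "cauchy_solution F T (\<rho>0, u0, \<theta>0) (\<rho>, u, \<theta>)"
    and "\<forall>t\<in>{0..T}. AE x in lebesgue. (\<rho> x t, u x t, \<theta> x t) \<in> state_domain C0 C1"
  shows "\<forall>t\<in>{0..T}. AE x in lebesgue.
    (let U = vector [\<rho> x t, u x t, \<theta> x t];
         Ux = vector [pd1 \<rho> x t, pd1 u x t, pd1 \<theta> x t]
     in (\<lambda>W. F0 F W Ux) differentiable (at U) \<and> invertible (DU_F0 F U Ux))"
proof -
  \<comment> \<open>The claim holds at every point whose state lies in the domain, so at each time
    the exceptional null set is the one on which the state leaves it.\<close>
  have "let U = vector [\<rho> x t, u x t, \<theta> x t];
         Ux = vector [pd1 \<rho> x t, pd1 u x t, pd1 \<theta> x t]
     in (\<lambda>W. F0 F W Ux) differentiable (at U) \<and> invertible (DU_F0 F U Ux)"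
    if "(\<rho> x t, u x t, \<theta> x t) \<in> state_domain C0 C1" for x t
    using that unfolding Let_def
    by (intro DU_F0_invertible[OF assms(1-5)]) (simp add: state_domain_def)
  then show ?thesis
    using assms(18) by (auto elim!: eventually_mono)
qed

end
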